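(* For every positive integer $n$ and every $w\in S_n$, the Di Francesco--Zinn-Justin polynomial $\mathcal{DZ}_w(\boldsymbol{x})$ has non-negative integer coefficients.
   Context: Let $\partial_i(f)=\dfrac{f(x_1,\ldots,x_{i-1},x_{i+1},x_i,x_{i+2},\ldots,x_n)-f(x_1,\ldots,x_n)}{x_{i+1}-x_i}$ and, for parameters $\alpha,\beta,\gamma$ and $1\le i\le n-1$, $$T_i^{(\alpha,\beta,\gamma)}=-\beta+\big((\alpha+\beta+\gamma)x_i+\gamma x_{i+1}+1+(\beta+\gamma)(\alpha+\gamma)x_ix_{i+1}\big)\partial_i .$$ These operators satisfy the braid relations, so $T_w^{(\alpha,\beta,\gamma)}=T_{i_1}^{(\alpha,\beta,\gamma)}\circ\cdots\circ T_{i_\ell}^{(\alpha,\beta,\gamma)}$ is well defined for any reduced decomposition $w=s_{i_1}\cdots s_{i_\ell}\in S_n$. Set $\mathcal{KN}_w^{(\alpha,\beta,\gamma)}(\boldsymbol{x};\boldsymbol{0})=T_w^{(\alpha,\beta,\gamma)}(x_1^{n-1}x_2^{n-2}\cdots x_{n-1})$. With $w_0\in S_n$ the long permutation $w_0(i)=n+1-i$, the Di Francesco--Zinn-Justin polynomials are $\mathcal{DZ}_w(\boldsymbol{x})=\mathcal{KN}_{w^{-1}w_0}^{(1,1,0)}(\boldsymbol{x};\boldsymbol{0})$, i.e. the specialization $\alpha=\beta=1$, $\gamma=0$. *)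

theory Defs
  imports Complex_Main "HOL-Library.Poly_Mapping" "HOL-Combinatorics.Permutations"
begin

text \<open>
  A monomial is a finitely supported exponent function on the indices of the variables
  \<open>x\<^sub>1, x\<^sub>2, \<dots>\<close>, and a polynomial is a finitely supported coefficient function on monomials.
  Polynomials in \<open>x\<^sub>1, \<dots>, x\<^sub>n\<close> are those elements in which only these variables occur.
\<close>

type_synonym 'a mpol = "(nat \<Rightarrow>\<^sub>0 nat) \<Rightarrow>\<^sub>0 'a"

definition X :: "nat \<Rightarrow> 'a::comm_ring_1 mpol" where
  "X i = Poly_Mapping.single (Poly_Mapping.single i 1) 1"

definition C :: "'a::comm_ring_1 \<Rightarrow> 'a mpol" where
  "C c = Poly_Mapping.single 0 c"

definition coefficient :: "'a::zero mpol \<Rightarrow> (nat \<Rightarrow>\<^sub>0 nat) \<Rightarrow> 'a" where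
  "coefficient f m = Poly_Mapping.lookup f m"

text \<open>
  Both maps below are involutions, so precomposing the coefficient function with the exchange of
  the \<open>i\<close>-th and \<open>(i+1)\<close>-st exponent is the substitution \<open>x\<^sub>i \<leftrightarrow> x\<^bsub>i+1\<^esub>\<close>.
\<close>

definition swap_exponents :: "nat \<Rightarrow> (nat \<Rightarrow>\<^sub>0 nat) \<Rightarrow> (nat \<Rightarrow>\<^sub>0 nat)" where
  "swap_exponents i m = Poly_Mapping.map_key (transpose i (Suc i)) m"

definition swap_vars :: "nat \<Rightarrow> 'a::comm_ring_1 mpol \<Rightarrow> 'a mpol" where
  "swap_vars i f = Poly_Mapping.map_key (swap_exponents i) f"

text \<open>
  The quotient exists for every \<open>f\<close> (lemma \<open>divided_difference\<close> below), and it is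
  unique.
\<close>

definition ddiff :: "nat \<Rightarrow> 'a::idom mpol \<Rightarrow> 'a mpol" where
  "ddiff i f = (THE g. (X (Suc i) - X i) * g = swap_vars i f - f)"

lemma transpose_Suc_inj: "inj (transpose i (Suc i))"
  by (metis injI transpose_involutory)

lemma lookup_swap_exponents:
  "Poly_Mapping.lookup (swap_exponents i m) k = Poly_Mapping.lookup m (transpose i (Suc i) k)"
  by (simp add: swap_exponents_def map_key.rep_eq transpose_Suc_inj)

lemma swap_exponents_invol [simp]: "swap_exponents i (swap_exponents i m) = m"
  by (rule poly_mapping_eqI) (simp add: lookup_swap_exponents)

lemma swap_exponents_inj: "inj (swap_exponents i)"
  by (rule injI) (metis swap_exponents_invol)

lemma swap_exponents_add: "swap_exponents i (m + m') = swap_exponents i m + swap_exponents i m'"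
  by (rule poly_mapping_eqI) (simp add: lookup_swap_exponents lookup_add)

lemma swap_vars_add: "swap_vars i (f + g) = swap_vars i f + swap_vars i g"
  by (simp add: swap_vars_def map_key_plus swap_exponents_inj)

lemma swap_vars_single:
  "swap_vars i (Poly_Mapping.single m c) = Poly_Mapping.single (swap_exponents i m) c"
  using map_key_single[OF swap_exponents_inj, of i "swap_exponents i m" c]
  by (simp add: swap_vars_def)

lemma swap_exponents_single:
  "swap_exponents i (Poly_Mapping.single k a) = Poly_Mapping.single (transpose i (Suc i) k) a"
  using map_key_single[OF transpose_Suc_inj, of i "transpose i (Suc i) k" a]
  by (simp add: swap_exponents_def)

lemma X_diff_nonzero: "(X (Suc i) - X i :: 'a::idom mpol) \<noteq> 0"
proof
  assume "(X (Suc i) - X i :: 'a mpol) = 0"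
  then have "Poly_Mapping.lookup (X (Suc i) :: 'a mpol) (Poly_Mapping.single i 1)
      = Poly_Mapping.lookup (X i :: 'a mpol) (Poly_Mapping.single i 1)"
    by simp
  moreover have "Poly_Mapping.single (Suc i) (1::nat) \<noteq> Poly_Mapping.single i 1"
    by (metis lookup_single_eq lookup_single_not_eq n_not_Suc_n zero_neq_one)
  ultimately show False
    by (simp add: X_def lookup_single_not_eq)
qed

lemma single_times_X:
  "X k * Poly_Mapping.single m c = Poly_Mapping.single (m + Poly_Mapping.single k 1) c"
  by (simp add: X_def mult_single add.commute)

lemma update_eq_plus_single:
  fixes f :: "'b \<Rightarrow>\<^sub>0 'c::monoid_add"
  assumes "k \<notin> Poly_Mapping.keys f"
  shows "Poly_Mapping.update k v f = f + Poly_Mapping.single k v"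
  using assms
  by (intro poly_mapping_eqI)
    (auto simp: lookup_update lookup_add lookup_single when_def in_keys_iff)

lemma X_diff_dvd_monomial_step:
  fixes c :: "'a::idom"
  assumes "(X (Suc i) - X i) dvd Poly_Mapping.single (swap_exponents i m) c - Poly_Mapping.single m c"
  shows "(X (Suc i) - X i) dvd Poly_Mapping.single (swap_exponents i (m + Poly_Mapping.single k 1)) c
           - Poly_Mapping.single (m + Poly_Mapping.single k 1) c"
proof -
  let ?k = "transpose i (Suc i) k"
  have "(X (Suc i) - X i :: 'a mpol) dvd X ?k - X k"
    using dvd_minus_iff[of "X (Suc i) - X i :: 'a mpol" "X (Suc i) - X i"]
    by (cases "k = i"; cases "k = Suc i") auto
  then have "(X (Suc i) - X i) dvd
      X ?k * (Poly_Mapping.single (swap_exponents i m) c - Poly_Mapping.single m c)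
        + (X ?k - X k) * Poly_Mapping.single m c"
    using assms by (intro dvd_add dvd_mult dvd_mult2)
  also have "\<dots> = X ?k * Poly_Mapping.single (swap_exponents i m) c - X k * Poly_Mapping.single m c"
    by (simp add: algebra_simps)
  finally show ?thesis
    by (simp only: single_times_X swap_exponents_add swap_exponents_single)
qed

lemma X_diff_dvd_monomial:
  "(X (Suc i) - X i) dvd
     Poly_Mapping.single (swap_exponents i m) c - Poly_Mapping.single m (c::'a::idom)"
proof (induction m rule: update_induct)
  case const
  then show ?case by (simp add: swap_exponents_def transpose_Suc_inj)
next
  case (update m k a)
  have "(X (Suc i) - X i) dvd Poly_Mapping.single (swap_exponents i (m + Poly_Mapping.single k b)) c
           - Poly_Mapping.single (m + Poly_Mapping.single k b) c" for b
  proof (induction b)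
    case 0
    then show ?case using update by simp
  next
    case (Suc b)
    have "m + Poly_Mapping.single k (Suc b) = m + Poly_Mapping.single k b + Poly_Mapping.single k 1"
      by (simp add: add.assoc flip: single_add)
    then show ?case using X_diff_dvd_monomial_step[OF Suc, of k] by simp
  qed
  then show ?case using update by (simp add: update_eq_plus_single)
qed

lemma X_diff_dvd: "(X (Suc i) - X i :: 'a::idom mpol) dvd swap_vars i f - f"
proof (induction f rule: update_induct)
  case const
  then show ?case by (simp add: swap_vars_def swap_exponents_inj)
next
  case (update f m c)
  have "swap_vars i (f + Poly_Mapping.single m c) - (f + Poly_Mapping.single m c)
      = (swap_vars i f - f) + (Poly_Mapping.single (swap_exponents i m) c - Poly_Mapping.single m c)"
    by (simp add: swap_vars_add swap_vars_single)
  then show ?case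
    using update X_diff_dvd_monomial[of i m c]
    by (simp only: update_eq_plus_single dvd_add not_False_eq_True)
qed

lemma divided_difference: "(X (Suc i) - X i) * ddiff i f = swap_vars i f - (f :: 'a::idom mpol)"
proof -
  obtain g where g: "(X (Suc i) - X i) * g = swap_vars i f - f"
    using X_diff_dvd[of i f] by (metis dvdE)
  have "g' = g" if "(X (Suc i) - X i) * g' = swap_vars i f - f" for g'
    using that g X_diff_nonzero[of i, where 'a = 'a] by (metis mult_left_cancel)
  then show ?thesis
    unfolding ddiff_def using g by (rule theI[rotated])
qed

definition T_simple :: "'a::idom \<Rightarrow> 'a \<Rightarrow> 'a \<Rightarrow> nat \<Rightarrow> 'a mpol \<Rightarrow> 'a mpol" where
  "T_simple \<alpha> \<beta> \<gamma> i f =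
     - C \<beta> * f
     + (C (\<alpha> + \<beta> + \<gamma>) * X i + C \<gamma> * X (Suc i) + 1
        + C ((\<beta> + \<gamma>) * (\<alpha> + \<gamma>)) * X i * X (Suc i)) * ddiff i f"

definition word_perm :: "nat list \<Rightarrow> nat \<Rightarrow> nat" where
  "word_perm is = foldr (\<lambda>i p. transpose i (Suc i) \<circ> p) is id"

definition reduced_word :: "nat \<Rightarrow> (nat \<Rightarrow> nat) \<Rightarrow> nat list \<Rightarrow> bool" where
  "reduced_word n w is \<longleftrightarrow>
     set is \<subseteq> {1..<n} \<and> word_perm is = w \<and>
     (\<forall>js. set js \<subseteq> {1..<n} \<and> word_perm js = w \<longrightarrow> length is \<le> length js)"

definition T_word :: "'a::idom \<Rightarrow> 'a \<Rightarrow> 'a \<Rightarrow> nat list \<Rightarrow> 'a mpol \<Rightarrow> 'a mpol" where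
  "T_word \<alpha> \<beta> \<gamma> is = foldr (\<lambda>i F. T_simple \<alpha> \<beta> \<gamma> i \<circ> F) is id"

text \<open>
  The operators satisfy the braid relations, so the choice of reduced word is immaterial; one
  exists for every permutation of \<open>{1..n}\<close> (lemma \<open>reduced_word_exists\<close> below).
\<close>

definition T_perm ::
    "nat \<Rightarrow> 'a::idom \<Rightarrow> 'a \<Rightarrow> 'a \<Rightarrow> (nat \<Rightarrow> nat) \<Rightarrow> 'a mpol \<Rightarrow> 'a mpol" where
  "T_perm n \<alpha> \<beta> \<gamma> w = T_word \<alpha> \<beta> \<gamma> (SOME is. reduced_word n w is)"

lemma word_perm_append: "word_perm (is @ js) = word_perm is \<circ> word_perm js"
  by (induction "is") (auto simp: word_perm_def)

lemma word_exists_transpose: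
  assumes "1 \<le> a" "a + d \<le> n"
  shows "\<exists>is. set is \<subseteq> {1..<n} \<and> word_perm is = transpose a (a + d)"
  using assms
proof (induction d)
  case 0
  then show ?case by (intro exI[of _ "[]"]) (simp add: word_perm_def)
next
  case (Suc d)
  then obtain "is" where "is": "set is \<subseteq> {1..<n}" "word_perm is = transpose a (a + d)"
    by auto
  show ?case
  proof (cases "d = 0")
    case True
    then show ?thesis using Suc.prems
      by (intro exI[of _ "[a]"]) (simp add: word_perm_def)
  next
    case False
    have s: "word_perm [a + d] = transpose (a + d) (Suc (a + d))"
      by (simp add: word_perm_def)
    have "word_perm ([a + d] @ is @ [a + d]) = transpose a (a + Suc d)"
      using False by (simp only: word_perm_append "is" s) (auto simp: transpose_def fun_eq_iff)
    moreover have "set ([a + d] @ is @ [a + d]) \<subseteq> {1..<n}"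
      using "is"(1) Suc.prems by auto
    ultimately show ?thesis by blast
  qed
qed

lemma reduced_word_exists:
  assumes "w permutes {1..n}"
  shows "\<exists>is. reduced_word n w is"
proof -
  have "\<exists>is. set is \<subseteq> {1..<n} \<and> word_perm is = w"
    using assms finite_atLeastAtMost[of 1 n]
  proof (induction w rule: permutes_induct)
    case id
    then show ?case by (intro exI[of _ "[]"]) (simp add: word_perm_def)
  next
    case (swap a b p)
    then obtain js where js: "set js \<subseteq> {1..<n}" "word_perm js = p" by blast
    obtain "is" where "is": "set is \<subseteq> {1..<n}" "word_perm is = transpose a b"
    proof (cases "a \<le> b")
      case True
      then show ?thesis using that word_exists_transpose[of a "b - a" n] swap(1,2) by auto
    next
      case False
      then show ?thesis using that word_exists_transpose[of b "a - b" n] swap(1,2)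
        by (auto simp: transpose_commute)
    qed
    show ?case
      using "is" js by (intro exI[of _ "is @ js"]) (auto simp: word_perm_append)
  qed
  then show ?thesis
    using ex_has_least_nat[of "\<lambda>is. set is \<subseteq> {1..<n} \<and> word_perm is = w" _ length]
    unfolding reduced_word_def by blast
qed

definition KN :: "nat \<Rightarrow> 'a::idom \<Rightarrow> 'a \<Rightarrow> 'a \<Rightarrow> (nat \<Rightarrow> nat) \<Rightarrow> 'a mpol" where
  "KN n \<alpha> \<beta> \<gamma> w = T_perm n \<alpha> \<beta> \<gamma> w (\<Prod>i = 1..n. X i ^ (n - i))"

definition longest_perm :: "nat \<Rightarrow> nat \<Rightarrow> nat" where
  "longest_perm n i = (if i \<in> {1..n} then n + 1 - i else i)"

text \<open>
  The coefficients are taken in the rationals, so that their integrality is part of the claim.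
\<close>

definition DZ :: "nat \<Rightarrow> (nat \<Rightarrow> nat) \<Rightarrow> rat mpol" where
  "DZ n w = KN n 1 1 0 (inv w \<circ> longest_perm n)"

end

theory Submission
  imports Defs
begin

text \<open>
  With \<open>\<alpha> = \<beta> = 1\<close> and \<open>\<gamma> = 0\<close> the operators are
  \<open>T\<^sub>i = - s\<^sub>i + (1 + x\<^sub>i) (1 + x\<^bsub>i+1\<^esub>) \<partial>\<^sub>i\<close>, where \<open>s\<^sub>i\<close> exchanges \<open>x\<^sub>i\<close> and \<open>x\<^bsub>i+1\<^esub>\<close>. In the variables
  \<open>u\<^sub>i = 1 / (1 + x\<^sub>i)\<close> this is the action of a degenerate Hecke algebra, which is also what the rational
  \<open>R\<close>-matrix \<open>u + P\<close> produces. The polynomials are therefore partition functions of a solvable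
  lattice model, and the weights of the model can be chosen to have non-negative coefficients.

  The model lives on an \<open>n \<times> n\<close> grid of rows \<open>1, \<dots>, n\<close>, counted from the top, and columns counted
  from the left. Every edge carries a label: a colour (a positive number), or \<open>0\<close> for a blank edge.
  Colours travel up and to the right. The left edge of row \<open>i\<close> carries the label \<open>l i\<close>, the bottom
  and right boundaries are blank, and the colours prescribed by a list leave through the top, one for
  each column. At a vertex of row \<open>k\<close> with label \<open>b\<close> below and \<open>p\<close> on the left, either both labels go
  straight on, with weight \<open>x\<^sub>k\<close>, or they bounce: \<open>p\<close> turns up and \<open>b\<close> turns right. A bounce of two
  colours has weight \<open>1 + x\<^sub>k\<close>; a colour that turns up next to a blank has weight \<open>1\<close>, and one that
  turns right has weight \<open>(1 + x\<^sub>k)\<^sup>2\<close>. A vertex with only blanks has total weight \<open>1\<close>.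

  Three facts give the theorem. The Yang-Baxter equation (\<open>yang_baxter\<close>) lets an exchange of two
  adjacent rows pass through a column, so the partition function \<open>Z l\<close> obeys an exchange relation
  which says, for rows \<open>i\<close> and \<open>i + 1\<close> that both carry colours, that \<open>T\<^sub>i (Z l) = Z (l \<circ> s\<^sub>i)\<close>
  (\<open>T_simple_partition\<close>). When row \<open>i\<close> has colour \<open>i\<close> and the colours leave in the order
  \<open>n, n - 1, \<dots>, 1\<close>, only one state contributes, of weight \<open>x\<^sub>1\<^bsup>n-1\<^esup> x\<^sub>2\<^bsup>n-2\<^esup> \<cdots> x\<^bsub>n-1\<^esub>\<close>
  (\<open>partition_staircase\<close>). Finally every partition function has coefficients in \<open>\<nat>\<close>
  (\<open>partition_nat_coeffs\<close>). So applying any \<open>T\<^sub>w\<close> to the staircase monomial merely permutes the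
  colours on the left boundary, and the result is again a sum of products of non-negative weights.
\<close>

section \<open>Exchanging variables is a ring homomorphism\<close>

lemma swap_vars_0 [simp]: "swap_vars i 0 = 0"
  by (simp add: swap_vars_def swap_exponents_inj)

lemma swap_vars_uminus: "swap_vars i (- f) = - swap_vars i f"
  by (metis add.right_inverse add_eq_0_iff swap_vars_0 swap_vars_add)

lemma swap_vars_diff: "swap_vars i (f - g) = swap_vars i f - swap_vars i g"
  by (metis diff_conv_add_uminus swap_vars_add swap_vars_uminus)

lemma swap_vars_1 [simp]: "swap_vars i 1 = 1"
proof -
  have "swap_exponents i 0 = 0"
    by (simp add: swap_exponents_def transpose_Suc_inj)
  then show ?thesis
    using swap_vars_single[of i 0 1] by (simp add: single_one)
qed

lemma swap_vars_single_mult: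
  "swap_vars i (Poly_Mapping.single m c * g) = swap_vars i (Poly_Mapping.single m c) * swap_vars i g"
proof (induction g rule: update_induct)
  case const
  then show ?case by simp
next
  case (update g m' c')
  then show ?case
    by (simp add: update_eq_plus_single distrib_left swap_vars_add mult_single swap_vars_single
        swap_exponents_add)
qed

lemma swap_vars_mult: "swap_vars i (f * g) = swap_vars i f * swap_vars i g"
proof (induction f rule: update_induct)
  case const
  then show ?case by simp
next
  case (update f m c)
  then show ?case
    by (simp add: update_eq_plus_single distrib_right swap_vars_add swap_vars_single_mult)
qed

lemma swap_vars_X [simp]: "swap_vars i (X k) = X (transpose i (Suc i) k)"
  by (simp add: X_def swap_vars_single swap_exponents_single)

lemmas swap_vars_hom = swap_vars_add swap_vars_diff swap_vars_uminus swap_vars_mult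

section \<open>Polynomials with natural coefficients\<close>

definition nat_coeffs :: "rat mpol set" where
  "nat_coeffs = {f. \<forall>m. coefficient f m \<in> \<nat>}"

lemma Sum_any_in_Nats:
  assumes "\<And>a. f a \<in> (\<nat> :: 'a::semiring_1 set)"
  shows "Sum_any f \<in> \<nat>"
proof -
  have "sum f A \<in> \<nat>" for A
    using assms by (induction A rule: infinite_finite_induct) auto
  then show ?thesis by (simp add: Sum_any.expand_set)
qed

lemma nat_coeffs_0 [intro, simp]: "0 \<in> nat_coeffs"
  by (simp add: nat_coeffs_def coefficient_def)

lemma nat_coeffs_1 [intro, simp]: "1 \<in> nat_coeffs"
  by (simp add: nat_coeffs_def coefficient_def lookup_one when_def)

lemma nat_coeffs_X [intro, simp]: "X k \<in> nat_coeffs"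
  by (simp add: nat_coeffs_def coefficient_def X_def lookup_single when_def)

lemma nat_coeffs_add [intro]: "f \<in> nat_coeffs \<Longrightarrow> g \<in> nat_coeffs \<Longrightarrow> f + g \<in> nat_coeffs"
  by (simp add: nat_coeffs_def coefficient_def lookup_add)

lemma nat_coeffs_mult [intro]: "f \<in> nat_coeffs \<Longrightarrow> g \<in> nat_coeffs \<Longrightarrow> f * g \<in> nat_coeffs"
  by (auto simp: nat_coeffs_def coefficient_def times_poly_mapping.rep_eq prod_fun_def when_def
      intro!: Sum_any_in_Nats Nats_mult)

section \<open>The Yang-Baxter equation\<close>

text \<open>
  The arguments \<open>b\<close> and \<open>p\<close> are the labels below and on the left of the vertex. At a blank vertex
  going straight and bouncing are the same state, so the two terms of that vertex add up to the
  weight \<open>1\<close>; splitting it as \<open>x + (1 - x)\<close> spares the case distinction in all the algebra below.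
\<close>

definition bounce :: "'a::comm_ring_1 \<Rightarrow> nat \<Rightarrow> nat \<Rightarrow> 'a" where
  "bounce x b p =
     (if b = 0 then (if p = 0 then 1 - x else 1) else (if p = 0 then (1 + x)\<^sup>2 else 1 + x))"

text \<open>
  The coefficient with which two adjacent rows, of parameters \<open>x\<close> and \<open>y\<close>, keep their labels \<open>p\<close> and
  \<open>q\<close> when their parameters are exchanged; the labels themselves are exchanged with coefficient
  \<open>- (x - y)\<close>. For two blanks both outcomes coincide, and the entry is chosen so that the total is
  \<open>1 + 2 x + x y\<close>: two blank rows are symmetric in their parameters.
\<close>

definition keep :: "'a::comm_ring_1 \<Rightarrow> 'a \<Rightarrow> nat \<Rightarrow> nat \<Rightarrow> 'a" where
  "keep x y p q =
     (if p = 0 then (if q = 0 then 1 + 3 * x - y + x * y else (1 + y)\<^sup>2)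
      else (if q = 0 then (1 + x)\<^sup>2 else (1 + x) * (1 + y)))"

text \<open>
  Two vertices of one column: \<open>x\<close> belongs to the upper row with left label \<open>p\<close>, \<open>y\<close> to the lower row
  with left label \<open>q\<close>, and \<open>b\<close> enters from below. In \<open>H t u v\<close> the label \<open>t\<close> leaves through the top
  and \<open>u\<close>, \<open>v\<close> leave to the right in the upper and the lower row.
\<close>

definition two_rows :: "'a::comm_ring_1 \<Rightarrow> 'a \<Rightarrow> (nat \<Rightarrow> nat \<Rightarrow> nat \<Rightarrow> 'a) \<Rightarrow> nat \<Rightarrow> nat \<Rightarrow> nat \<Rightarrow> 'a" where
  "two_rows x y H b p q =
     y * (x * H b p q + bounce x b p * H p b q)
     + bounce y b q * (x * H q p b + bounce x q p * H p q b)"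

text \<open>
  If \<open>H'\<close> is obtained from \<open>H\<close> by exchanging the row parameters on the right of the column, then
  the same relation holds on the left of it. Every weight depends only on which labels are blank, so
  eight polynomial identities cover all colours.
\<close>

lemma yang_baxter:
  fixes x y :: "'a::comm_ring_1"
  assumes H: "\<And>t u v. (1 + 2 * x + x * y) * H' t u v = keep x y u v * H t u v - (x - y) * H t v u"
  shows "(1 + 2 * x + x * y) * two_rows y x H' b p q
       = keep x y p q * two_rows x y H b p q - (x - y) * two_rows x y H b q p"
proof -
  let ?Q = "1 + 2 * x + x * y"
  have "?Q * two_rows y x H' b p q
      = x * (y * (?Q * H' b p q) + bounce y b p * (?Q * H' p b q))
        + bounce x b q * (y * (?Q * H' q p b) + bounce y q p * (?Q * H' p q b))"
    by (simp add: two_rows_def algebra_simps)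
  also have "\<dots> = keep x y p q * two_rows x y H b p q - (x - y) * two_rows x y H b q p"
    unfolding H two_rows_def bounce_def keep_def
    by (cases "b = 0"; cases "p = 0"; cases "q = 0"; simp add: algebra_simps power2_eq_square)
  finally show ?thesis .
qed

section \<open>Partition functions\<close>

text \<open>
  The rows \<open>k, \<dots>, 1\<close> of a column with top label \<open>t\<close>, entered from below by \<open>b\<close>. The function \<open>l\<close>
  holds the left labels of the rows still to come and the right labels of the rows already passed;
  \<open>G\<close> is the partition function of the columns further to the right.
\<close>

fun column :: "((nat \<Rightarrow> nat) \<Rightarrow> rat mpol) \<Rightarrow> nat \<Rightarrow> nat \<Rightarrow> nat \<Rightarrow> (nat \<Rightarrow> nat) \<Rightarrow> rat mpol" where
  "column G t 0 b l = (if b = t then G l else 0)"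
| "column G t (Suc k) b l =
     X (Suc k) * column G t k b l
     + bounce (X (Suc k)) b (l (Suc k)) * column G t k (l (Suc k)) (l(Suc k := b))"

fun partition_function :: "nat \<Rightarrow> nat list \<Rightarrow> (nat \<Rightarrow> nat) \<Rightarrow> rat mpol" where
  "partition_function n [] l = (if \<forall>i\<in>{1..n}. l i = 0 then 1 else 0)"
| "partition_function n (t # ts) l = column (partition_function n ts) t n 0 l"

lemma bounce_vertex_nat_coeffs:
  assumes "f \<in> nat_coeffs" "g \<in> nat_coeffs" "b = 0 \<Longrightarrow> p = 0 \<Longrightarrow> f = g"
  shows "X k * f + bounce (X k) b p * g \<in> nat_coeffs"
proof (cases "b = 0 \<and> p = 0")
  case True
  then show ?thesis
    using assms by (simp add: bounce_def algebra_simps)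
next
  case False
  then have "bounce (X k) b p \<in> nat_coeffs"
    by (auto simp: bounce_def power2_eq_square)
  then show ?thesis
    using assms by auto
qed

lemma column_nat_coeffs:
  assumes "\<And>l. G l \<in> nat_coeffs"
  shows "column G t k b l \<in> nat_coeffs"
proof (induction k arbitrary: b l)
  case 0
  then show ?case using assms by simp
next
  case (Suc k)
  have "l(Suc k := b) = l" if "b = 0" "l (Suc k) = 0"
    using that by auto
  then show ?case
    unfolding column.simps by (intro bounce_vertex_nat_coeffs Suc.IH) simp
qed

lemma partition_nat_coeffs: "partition_function n ts l \<in> nat_coeffs"
  by (induction ts arbitrary: l) (auto intro: column_nat_coeffs)

section \<open>The exchange relation\<close>

definition exchange :: "nat \<Rightarrow> ((nat \<Rightarrow> nat) \<Rightarrow> rat mpol) \<Rightarrow> bool" where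
  "exchange i F \<longleftrightarrow> (\<forall>l.
     (1 + 2 * X i + X i * X (Suc i)) * swap_vars i (F l) =
     keep (X i) (X (Suc i)) (l i) (l (Suc i)) * F l
     - (X i - X (Suc i)) * F (l \<circ> transpose i (Suc i)))"

lemma swap_vars_bounce: "swap_vars i (bounce x b p) = bounce (swap_vars i x) b p"
  by (simp add: bounce_def swap_vars_hom power2_eq_square)

text \<open>A vertex in a row other than \<open>i\<close> and \<open>i + 1\<close> has a weight that the exchange does not affect.\<close>

lemma exchange_vertex:
  assumes F: "\<And>b. exchange i (F b)" and j: "j \<noteq> i" "j \<noteq> Suc i"
  shows "exchange i (\<lambda>l. X j * F b l + bounce (X j) b (l j) * F (l j) (l(j := b)))"
  unfolding exchange_def
proof
  fix l :: "nat \<Rightarrow> nat"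
  let ?s = "transpose i (Suc i)" and ?Q = "1 + 2 * X i + X i * X (Suc i) :: rat mpol"
  have s: "?s j = j" using j by (simp add: transpose_def)
  have upd: "(l \<circ> ?s)(j := b) = l(j := b) \<circ> ?s"
    using j by (auto simp: transpose_def fun_eq_iff)
  have E: "?Q * swap_vars i (F c r) = keep (X i) (X (Suc i)) (r i) (r (Suc i)) * F c r
      - (X i - X (Suc i)) * F c (r \<circ> ?s)" for c r
    using F by (simp add: exchange_def)
  have "?Q * swap_vars i (X j * F b l + bounce (X j) b (l j) * F (l j) (l(j := b)))
      = X j * (?Q * swap_vars i (F b l))
        + bounce (X j) b (l j) * (?Q * swap_vars i (F (l j) (l(j := b))))"
    by (simp add: swap_vars_hom swap_vars_bounce s algebra_simps)
  also have "\<dots> = keep (X i) (X (Suc i)) (l i) (l (Suc i))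
        * (X j * F b l + bounce (X j) b (l j) * F (l j) (l(j := b)))
      - (X i - X (Suc i)) * (X j * F b (l \<circ> ?s)
        + bounce (X j) b ((l \<circ> ?s) j) * F ((l \<circ> ?s) j) ((l \<circ> ?s)(j := b)))"
    unfolding E upd using j by (simp add: s algebra_simps)
  finally show "?Q * swap_vars i (X j * F b l + bounce (X j) b (l j) * F (l j) (l(j := b))) =
    keep (X i) (X (Suc i)) (l i) (l (Suc i))
      * (X j * F b l + bounce (X j) b (l j) * F (l j) (l(j := b)))
    - (X i - X (Suc i)) * (X j * F b (l \<circ> ?s)
        + bounce (X j) b ((l \<circ> ?s) j) * F ((l \<circ> ?s) j) ((l \<circ> ?s)(j := b)))" .
qed

lemma column_two_rows:
  assumes "k = Suc j"
  shows "column G t (Suc k) b l =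
    two_rows (X k) (X (Suc k)) (\<lambda>t' u v. column G t j t' (l(k := u, Suc k := v))) b (l k) (l (Suc k))"
proof -
  have "l(k := l k, Suc k := l (Suc k)) = l"
    and "l(k := b, Suc k := l (Suc k)) = l(k := b)"
    and "l(k := l k, Suc k := b) = l(Suc k := b)"
    and "l(Suc k := b, k := l (Suc k)) = l(k := l (Suc k), Suc k := b)"
    by auto
  then show ?thesis
    unfolding assms two_rows_def by simp
qed

lemma exchange_column_pair:
  assumes k: "k = Suc j" and E: "\<And>b. exchange k (column G t j b)"
  shows "exchange k (column G t (Suc k) b)"
  unfolding exchange_def
proof
  fix l :: "nat \<Rightarrow> nat"
  let ?s = "transpose k (Suc k)"
  define H where "H = (\<lambda>t' u v. column G t j t' (l(k := u, Suc k := v)))"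
  have upd: "l(k := u, Suc k := v) \<circ> ?s = l(k := v, Suc k := u)" for u v
    by (auto simp: transpose_def fun_eq_iff)
  have "(1 + 2 * X k + X k * X (Suc k)) * swap_vars k (H t' u v)
      = keep (X k) (X (Suc k)) u v * H t' u v - (X k - X (Suc k)) * H t' v u" for t' u v
    using E[of t', unfolded exchange_def, rule_format, of "l(k := u, Suc k := v)"]
    by (simp add: H_def upd)
  note yb = yang_baxter[of "X k" "X (Suc k)" "\<lambda>t' u v. swap_vars k (H t' u v)", OF this,
      of b "l k" "l (Suc k)"]
  have left: "column G t (Suc k) b l = two_rows (X k) (X (Suc k)) H b (l k) (l (Suc k))"
    unfolding H_def by (rule column_two_rows[OF k])
  have "(l \<circ> ?s)(k := u, Suc k := v) = l(k := u, Suc k := v)" for u v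
    by (auto simp: transpose_def fun_eq_iff)
  then have right: "column G t (Suc k) b (l \<circ> ?s)
      = two_rows (X k) (X (Suc k)) H b (l (Suc k)) (l k)"
    unfolding H_def column_two_rows[OF k] by simp
  have "swap_vars k (two_rows (X k) (X (Suc k)) H b (l k) (l (Suc k)))
      = two_rows (X (Suc k)) (X k) (\<lambda>t' u v. swap_vars k (H t' u v)) b (l k) (l (Suc k))"
    by (simp add: two_rows_def swap_vars_hom swap_vars_bounce)
  then show "(1 + 2 * X k + X k * X (Suc k)) * swap_vars k (column G t (Suc k) b l) =
      keep (X k) (X (Suc k)) (l k) (l (Suc k)) * column G t (Suc k) b l
      - (X k - X (Suc k)) * column G t (Suc k) b (l \<circ> ?s)"
    unfolding left right by (simp only: yb)
qed

text \<open>
  The relation fails for \<open>k = i\<close>, where the column has been passed in only one of the two rows that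
  are exchanged; so the induction has to jump from \<open>i - 1\<close> to \<open>i + 1\<close>.
\<close>

lemma exchange_column:
  assumes G: "exchange i G" and i: "1 \<le> i" and k: "k \<noteq> i"
  shows "exchange i (column G t k b)"
  using k
proof (induction k arbitrary: b rule: less_induct)
  case (less k)
  show ?case
  proof (cases k)
    case 0
    then show ?thesis
      using G by (cases "b = t") (auto simp: exchange_def)
  next
    case (Suc j)
    show ?thesis
    proof (cases "j = i")
      case True
      then have "exchange i (column G t (i - 1) c)" for c
        using i Suc by (intro less.IH) auto
      then show ?thesis
        unfolding Suc True using i by (intro exchange_column_pair[of i "i - 1"]) auto
    next
      case False
      then have "exchange i (column G t j c)" for c
        using Suc by (intro less.IH) auto
      then show ?thesis
        using exchange_vertex[of i "column G t j" k b] Suc less.prems False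
        by (simp add: fun_eq_iff)
    qed
  qed
qed

lemma exchange_partition:
  assumes i: "1 \<le> i" "i < n"
  shows "exchange i (partition_function n ts)"
proof (induction ts)
  case Nil
  have blank: "(\<forall>j\<in>{1..n}. (l \<circ> transpose i (Suc i)) j = 0) \<longleftrightarrow> (\<forall>j\<in>{1..n}. l j = 0)"
    for l :: "nat \<Rightarrow> nat"
  proof -
    have "transpose i (Suc i) ` {1..n} = {1..n}"
      using i by (intro permutes_image permutes_swap_id) auto
    then show ?thesis
      by (metis (mono_tags, lifting) comp_apply image_eqI imageE)
  qed
  show ?case
    unfolding exchange_def partition_function.simps blank
    using i by (auto simp: keep_def algebra_simps)
next
  case (Cons t ts)
  then show ?case
    using exchange_column[of i "partition_function n ts" n t 0] i by (simp add: exchange_def)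
qed

text \<open>
  For two coloured rows the exchange relation is
  \<open>(A + x\<^sub>i - x\<^bsub>i+1\<^esub>) s\<^sub>i Z = A Z - (x\<^sub>i - x\<^bsub>i+1\<^esub>) Z'\<close> with \<open>A = (1 + x\<^sub>i) (1 + x\<^bsub>i+1\<^esub>)\<close>, and solving it for
  \<open>Z'\<close> gives the operator \<open>T\<^sub>i\<close>.
\<close>

lemma T_simple_partition:
  assumes i: "1 \<le> i" "i < n" and col: "l i \<noteq> 0" "l (Suc i) \<noteq> 0"
  shows "T_simple 1 1 0 i (partition_function n ts l) = partition_function n ts (l \<circ> transpose i (Suc i))"
proof -
  let ?Z = "partition_function n ts l" and ?Z' = "partition_function n ts (l \<circ> transpose i (Suc i))"
  let ?x = "X i :: rat mpol" and ?y = "X (Suc i) :: rat mpol"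
  have C: "C 1 = (1 :: rat mpol)" "C 0 = (0 :: rat mpol)" "C 2 = (2 :: rat mpol)"
    by (simp_all add: C_def single_one single_numeral)
  have E: "(1 + 2 * ?x + ?x * ?y) * swap_vars i ?Z = (1 + ?x) * (1 + ?y) * ?Z - (?x - ?y) * ?Z'"
    using exchange_partition[OF i, of ts] col by (simp add: exchange_def keep_def)
  have "(?y - ?x) * T_simple 1 1 0 i ?Z
      = (?x - ?y) * ?Z + (1 + 2 * ?x + ?x * ?y) * ((?y - ?x) * ddiff i ?Z)"
    by (simp add: T_simple_def C algebra_simps)
  also have "\<dots> = (?x - ?y) * ?Z + ((1 + 2 * ?x + ?x * ?y) * swap_vars i ?Z
      - (1 + 2 * ?x + ?x * ?y) * ?Z)"
    unfolding divided_difference by (simp add: right_diff_distrib)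
  also have "\<dots> = (?y - ?x) * ?Z'"
    unfolding E by (simp add: algebra_simps)
  finally show ?thesis
    using X_diff_nonzero[of i, where 'a = rat] by simp
qed

lemma T_word_partition:
  assumes "set is \<subseteq> {1..<n}" and "\<forall>i\<in>{1..n}. l i \<noteq> 0"
  shows "\<exists>l'. (\<forall>i\<in>{1..n}. l' i \<noteq> 0) \<and> T_word 1 1 0 is (partition_function n ts l) = partition_function n ts l'"
  using assms(1)
proof (induction "is")
  case Nil
  then show ?case using assms(2) by (auto simp: T_word_def)
next
  case (Cons i "is")
  then obtain l' where l': "\<forall>i\<in>{1..n}. l' i \<noteq> 0"
    and eq: "T_word 1 1 0 is (partition_function n ts l) = partition_function n ts l'"
    by auto
  have "T_word 1 1 0 (i # is) (partition_function n ts l) = partition_function n ts (l' \<circ> transpose i (Suc i))"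
    using T_simple_partition[of i n l' ts] Cons.prems l' eq by (simp add: T_word_def)
  moreover have "\<forall>j\<in>{1..n}. (l' \<circ> transpose i (Suc i)) j \<noteq> 0"
    using l' Cons.prems by (auto simp: transpose_def)
  ultimately show ?case by blast
qed

section \<open>The staircase monomial\<close>

text \<open>Colours are conserved, so a colour that enters on the left must occur among the top labels.\<close>

lemma column_eq_0_of_colour:
  assumes G: "\<And>l. \<exists>i\<in>{1..n}. l i = c \<Longrightarrow> G l = 0"
    and "c \<noteq> t" and "k \<le> n" and "b = c \<or> (\<exists>i\<in>{1..n}. l i = c)"
  shows "column G t k b l = 0"
  using assms(3,4)
proof (induction k arbitrary: b l)
  case 0
  then show ?case using G \<open>c \<noteq> t\<close> by auto
next
  case (Suc k)
  have "column G t k b l = 0"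
    using Suc by auto
  moreover have "l (Suc k) = c \<or> (\<exists>i\<in>{1..n}. (l(Suc k := b)) i = c)"
  proof (cases "b = c")
    case True
    then show ?thesis using Suc.prems(1) by (intro disjI2 bexI[of _ "Suc k"]) auto
  next
    case False
    then obtain i where "i \<in> {1..n}" "l i = c" using Suc.prems(2) by blast
    then show ?thesis by (cases "i = Suc k") auto
  qed
  then have "column G t k (l (Suc k)) (l(Suc k := b)) = 0"
    using Suc.prems(1) by (intro Suc.IH) auto
  ultimately show ?case by simp
qed

lemma partition_eq_0_of_colour:
  assumes "i \<in> {1..n}" "l i \<noteq> 0" "l i \<notin> set ts"
  shows "partition_function n ts l = 0"
proof -
  have "(\<exists>i\<in>{1..n}. l i = c) \<Longrightarrow> partition_function n ts l = 0" if "c \<noteq> 0" "c \<notin> set ts" for c l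
    using that(2)
  proof (induction ts arbitrary: l)
    case Nil
    then show ?case using that(1) by auto
  next
    case (Cons t ts)
    then have "column (partition_function n ts) t n 0 l = 0"
      by (intro column_eq_0_of_colour[where n = n and c = c]) auto
    then show ?case by simp
  qed
  then show ?thesis using assms by blast
qed

text \<open>A colour that has gone right past the column for which it is destined cannot come back.\<close>

lemma column_eq_0_of_passed:
  assumes "k < i" "i \<in> {1..n}" "l i \<noteq> 0" "l i \<notin> set ts"
  shows "column (partition_function n ts) t k b l = 0"
  using assms
proof (induction k arbitrary: b l)
  case 0
  then show ?case using partition_eq_0_of_colour[of i n l ts] by simp
next
  case (Suc k)
  then show ?case by simp
qed

text \<open>Colour \<open>k\<close>, once it has turned up, crosses all the smaller colours.\<close>

lemma column_cross:
  assumes "j < k" "k \<le> n" "\<And>i. i \<in> {1..j} \<Longrightarrow> l i = i" "k \<notin> set ts"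
  shows "column (partition_function n ts) k j k l = (\<Prod>i=1..j. X i) * partition_function n ts l"
  using assms
proof (induction j)
  case 0
  then show ?case by simp
next
  case (Suc j)
  have "column (partition_function n ts) k j (l (Suc j)) (l(Suc j := k)) = 0"
    using Suc.prems by (intro column_eq_0_of_passed[where i = "Suc j"]) auto
  then show ?case
    using Suc by (simp add: mult_ac)
qed

text \<open>
  Below row \<open>k\<close> everything is blank; in row \<open>k\<close> the colour \<open>k\<close> has to turn up, as it could not
  leave through this column otherwise.
\<close>

lemma column_staircase:
  fixes l :: "nat \<Rightarrow> nat"
  assumes k: "1 \<le> k" "k \<le> n" "k \<le> j" "j \<le> n"
    and l: "\<And>i. i \<in> {1..k} \<Longrightarrow> l i = i" "\<And>i. i \<in> {k<..n} \<Longrightarrow> l i = 0"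
    and ts: "k \<notin> set ts"
  shows "column (partition_function n ts) k j 0 l = (\<Prod>i=1..<k. X i) * partition_function n ts (l(k := 0))"
  using k(3,4)
proof (induction j rule: dec_induct)
  case base
  obtain k' where k': "k = Suc k'" using k by (cases k) auto
  have "column (partition_function n ts) k k' 0 l = 0"
    using k k' l ts by (intro column_eq_0_of_passed[where i = k]) auto
  moreover have "column (partition_function n ts) k k' k (l(k := 0))
      = (\<Prod>i=1..k'. X i) * partition_function n ts (l(k := 0))"
    using k k' l ts by (intro column_cross) auto
  moreover have "{1..k'} = {1..<k}" using k' by auto
  ultimately show ?case
    using k l(1)[of k] unfolding k' column.simps by (simp add: bounce_def del: fun_upd_apply)
next
  case (step j)
  have "l (Suc j) = 0" using l(2) step by auto
  moreover from this have "l(Suc j := 0) = l" by auto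
  ultimately show ?case
    using step by (simp add: bounce_def algebra_simps)
qed

lemma partition_staircase_aux:
  assumes "k \<le> n"
  shows "partition_function n (rev [1..<Suc k]) (\<lambda>i. if i \<le> k then i else 0) = (\<Prod>i=1..k. X i ^ (k - i))"
  using assms
proof (induction k)
  case 0
  then show ?case by simp
next
  case (Suc k)
  have upd: "(\<lambda>i. if i \<le> Suc k then i else 0)(Suc k := 0) = (\<lambda>i. if i \<le> k then i else 0)"
    by (auto simp: fun_eq_iff)
  have "partition_function n (rev [1..<Suc (Suc k)]) (\<lambda>i. if i \<le> Suc k then i else 0)
      = column (partition_function n (rev [1..<Suc k])) (Suc k) n 0 (\<lambda>i. if i \<le> Suc k then i else 0)"
    by simp
  also have "\<dots> = (\<Prod>i=1..<Suc k. X i) * (\<Prod>i=1..k. X i ^ (k - i))"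
    using Suc column_staircase[of "Suc k" n n "\<lambda>i. if i \<le> Suc k then i else 0" "rev [1..<Suc k]"]
    unfolding upd by simp
  also have "\<dots> = (\<Prod>i=1..k. X i ^ (Suc k - i))"
    unfolding atLeastLessThanSuc_atLeastAtMost prod.distrib[symmetric]
    by (intro prod.cong refl) (simp add: Suc_diff_le)
  finally show ?case by simp
qed

lemma partition_staircase:
  "\<exists>l. (\<forall>i\<in>{1..n}. l i \<noteq> 0) \<and> partition_function n (rev [1..<Suc n]) l = (\<Prod>i=1..n. X i ^ (n - i))"
  using partition_staircase_aux[of n n] by (intro exI[of _ "\<lambda>i. if i \<le> n then i else 0"]) auto

section \<open>Positivity\<close>

lemma longest_perm_permutes: "longest_perm n permutes {1..n}"
proof (rule bij_imp_permutes)
  show "bij_betw (longest_perm n) {1..n} {1..n}"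
    by (rule bij_betwI[where g = "longest_perm n"]) (auto simp: longest_perm_def)
qed (auto simp: longest_perm_def)

theorem corollary5p6:
  fixes n :: nat and w :: "nat \<Rightarrow> nat" and m :: "nat \<Rightarrow>\<^sub>0 nat"
  assumes "n \<ge> 1" and "w permutes {1..n}"
  shows "coefficient (DZ n w) m \<in> \<nat>"
proof -
  let ?v = "inv w \<circ> longest_perm n"
  have "?v permutes {1..n}"
    using assms(2) longest_perm_permutes by (intro permutes_compose permutes_inv)
  then have red: "reduced_word n ?v (SOME is. reduced_word n ?v is)"
    by (rule someI_ex[OF reduced_word_exists])
  obtain l where l: "\<forall>i\<in>{1..n}. l i \<noteq> 0"
    and Z: "partition_function n (rev [1..<Suc n]) l = (\<Prod>i=1..n. X i ^ (n - i))"
    using partition_staircase by blast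
  obtain l' where "DZ n w = partition_function n (rev [1..<Suc n]) l'"
    using T_word_partition[of "SOME is. reduced_word n ?v is" n l "rev [1..<Suc n]"] red l
    unfolding DZ_def KN_def T_perm_def Z reduced_word_def by blast
  then have "DZ n w \<in> nat_coeffs"
    by (simp only: partition_nat_coeffs)
  then show ?thesis
    by (simp add: nat_coeffs_def)
qed

end
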